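(* Let $p=(v_1,\dots,v_n)$ be a spherical polygon, with angles $\alpha_1,\dots,\alpha_n$, and let $\dot\alpha_1,\dots,\dot\alpha_n\in\mathbb{R}$ be a first-order variation of its angles induced by an isometric first-order deformation of $p$. Then $$\sum_{i=1}^n\dot\alpha_i v_i=0,$$ where the $v_i$ are considered as points of $S^2\subset\mathbb{R}^3$. Conversely, if this equation is satisfied by an $n$-tuple $(\dot\alpha_1,\dots,\dot\alpha_n)\in\mathbb{R}^n$ and moreover the $v_i$ are not all on a great circle, then there exists an isometric first-order deformation of $p$ such that the $\dot\alpha_i$ are the associated first-order variations of the $\alpha_i$.
   Context: $S^2$ is the unit sphere in $\mathbb{R}^3$. A spherical polygon with $n\ge 3$ vertices is a finite sequence $p=(v_1,\dots,v_n)$ of points of $S^2$ such that, for all $i$ (indices modulo $n$), $v_i\ne v_{i+1}$ and $v_i\neq -v_{i+1}$. Its edges are the minimizing geodesic segments from $v_i$ to $v_{i+1}$. The angle $\alpha_i\in\mathbb{R}/2\pi\mathbb{Z}$ at $v_i$ is the oriented angle in $T_{v_i}S^2$ (for a fixed orientation of $S^2$) from the direction at $v_i$ of the edge towards $v_{i+1}$ to the direction at $v_i$ of the edge towards $v_{i-1}$. A first-order deformation of $p$ is an $n$-tuple $(\dot v_1,\dots,\dot v_n)$ with $\dot v_i\in T_{v_i}S^2$; it is isometric if $\langle\dot v_i,v_{i+1}\rangle+\langle v_i,\dot v_{i+1}\rangle=0$ for all $i$ (edge lengths do not change at first order). The induced first-order variation of the angles is the derivative of $(\alpha_1,\dots,\alpha_n)$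 in the direction $(\dot v_1,\dots,\dot v_n)$. *)

theory Defs
  imports "HOL-Analysis.Analysis" "HOL-Library.Real_Mod"
begin

unbundle cross3_syntax

text \<open>
  A polygon with n vertices is a function on naturals of which only the values at
  0, ..., n - 1 matter; the successor and predecessor of the index i modulo n are
  \<^term>\<open>(i + 1) mod n\<close> and \<^term>\<open>(i + n - 1) mod n\<close>.
\<close>

definition spherical_polygon :: "nat \<Rightarrow> (nat \<Rightarrow> real^3) \<Rightarrow> bool" where
  "spherical_polygon n p \<longleftrightarrow> n \<ge> 3 \<and>
     (\<forall>i<n. p i \<in> sphere 0 1 \<and> p i \<noteq> p ((i + 1) mod n) \<and> p i \<noteq> - p ((i + 1) mod n))"

text \<open>
  For unit vectors x and \<open>y \<noteq> \<plusminus>x\<close>, the unit vector u orthogonal to x such that the minimizing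
  geodesic from x to y is \<open>t \<mapsto> cos t x + sin t u\<close>: the normalized projection of y to the
  tangent plane at x.
\<close>

definition edge_direction :: "real^3 \<Rightarrow> real^3 \<Rightarrow> real^3" where
  "edge_direction x y = sgn (y - (x \<bullet> y) *\<^sub>R x)"

text \<open>
  An orientation of the sphere is a sign s: the rotation by a positive right angle in the tangent
  plane at x is \<open>u \<mapsto> s (x \<times> u)\<close>, and s = 1 is the orientation given by the outward normal.
  The oriented angle from u to w is the argument of w in the complex coordinate of the tangent
  plane with basis u, \<open>s (x \<times> u)\<close>.  It is an element of the reals modulo \<open>2 \<pi>\<close>,
  represented here by its value in \<open>(-\<pi>, \<pi>]\<close>.
\<close>

definition oriented_angle :: "real \<Rightarrow> real^3 \<Rightarrow> real^3 \<Rightarrow> real^3 \<Rightarrow> real" where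
  "oriented_angle s x u w = Arg (Complex (u \<bullet> w) ((s *\<^sub>R (x \<times> u)) \<bullet> w))"

definition polygon_angle :: "real \<Rightarrow> nat \<Rightarrow> (nat \<Rightarrow> real^3) \<Rightarrow> nat \<Rightarrow> real" where
  "polygon_angle s n p i = oriented_angle s (p i)
     (edge_direction (p i) (p ((i + 1) mod n)))
     (edge_direction (p i) (p ((i + n - 1) mod n)))"

definition first_order_deformation :: "nat \<Rightarrow> (nat \<Rightarrow> real^3) \<Rightarrow> (nat \<Rightarrow> real^3) \<Rightarrow> bool" where
  "first_order_deformation n p w \<longleftrightarrow> (\<forall>i<n. w i \<bullet> p i = 0)"

definition isometric_deformation :: "nat \<Rightarrow> (nat \<Rightarrow> real^3) \<Rightarrow> (nat \<Rightarrow> real^3) \<Rightarrow> bool" where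
  "isometric_deformation n p w \<longleftrightarrow> first_order_deformation n p w \<and>
     (\<forall>i<n. w i \<bullet> p ((i + 1) mod n) + p i \<bullet> w ((i + 1) mod n) = 0)"

text \<open>
  Derivative of a function f with values in the reals modulo \<open>2 \<pi>\<close>, given by
  representatives: the derivative of a local real-valued lift.
\<close>

definition has_angle_derivative :: "(real \<Rightarrow> real) \<Rightarrow> real \<Rightarrow> real \<Rightarrow> bool" where
  "has_angle_derivative f d t0 \<longleftrightarrow>
     (\<exists>\<theta>. (\<forall>\<^sub>F t in nhds t0. [f t = \<theta> t] (rmod 2 * pi)) \<and>
          (\<theta> has_real_derivative d) (at t0))"

definition deformation_curve ::
    "nat \<Rightarrow> (nat \<Rightarrow> real^3) \<Rightarrow> (nat \<Rightarrow> real^3) \<Rightarrow> (real \<Rightarrow> nat \<Rightarrow> real^3) \<Rightarrow> bool" where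
  "deformation_curve n p w c \<longleftrightarrow>
     (\<forall>i<n. (\<forall>t. c t i \<in> sphere 0 1) \<and> c 0 i = p i \<and>
            ((\<lambda>t. c t i) has_vector_derivative w i) (at 0))"

text \<open>
  The derivative of the angles in the direction w, computed along every curve of n-tuples on the
  sphere with initial velocity w.  Such curves exist (\<open>deformation_curve_exists\<close> below), so
  that the condition determines the angle variation.
\<close>

definition angle_variation ::
    "real \<Rightarrow> nat \<Rightarrow> (nat \<Rightarrow> real^3) \<Rightarrow> (nat \<Rightarrow> real^3) \<Rightarrow> (nat \<Rightarrow> real) \<Rightarrow> bool" where
  "angle_variation s n p w a \<longleftrightarrow>
     (\<forall>c. deformation_curve n p w c \<longrightarrow>
        (\<forall>i<n. has_angle_derivative (\<lambda>t. polygon_angle s n (c t) i) (a i) 0))"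

definition great_circle :: "(real^3) set \<Rightarrow> bool" where
  "great_circle C \<longleftrightarrow> (\<exists>P. subspace P \<and> dim P = 2 \<and> C = sphere 0 1 \<inter> P)"

lemma deformation_curve_exists:
  assumes "\<forall>i<n. p i \<in> sphere 0 1" and "first_order_deformation n p w"
  shows "\<exists>c. deformation_curve n p w c"
proof -
  define c where "c t i = cos (t * norm (w i)) *\<^sub>R p i + sin (t * norm (w i)) *\<^sub>R sgn (w i)"
    for t i
  have "c t i \<in> sphere 0 1 \<and> c 0 i = p i \<and> ((\<lambda>t. c t i) has_vector_derivative w i) (at 0)"
    if "i < n" for t i
  proof (intro conjI)
    have p: "p i \<bullet> p i = 1" and o: "p i \<bullet> w i = 0"
      using assms that
      by (auto simp: first_order_deformation_def inner_commute simp flip: power2_norm_eq_inner)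
    have "(norm (c t i))\<^sup>2 = 1"
    proof (cases "w i = 0")
      case True
      then show ?thesis
        using p by (simp add: c_def power2_norm_eq_inner)
    next
      case False
      then have "sgn (w i) \<bullet> sgn (w i) = 1"
        by (metis norm_sgn power2_norm_eq_inner power_one)
      moreover have "p i \<bullet> sgn (w i) = 0"
        using o by (simp add: sgn_div_norm)
      ultimately show ?thesis
        using p sin_cos_squared_add2[of "t * norm (w i)"]
        by (simp add: c_def power2_norm_eq_inner inner_add_left inner_add_right
            inner_commute[of "sgn (w i)" "p i"] flip: power2_eq_square)
    qed
    then show "c t i \<in> sphere 0 1"
      by (simp add: power2_eq_1_iff) (metis norm_ge_zero not_one_le_zero neg_0_le_iff_le)
    show "c 0 i = p i"
      by (simp add: c_def)
    have "((\<lambda>t. c t i) has_vector_derivative norm (w i) *\<^sub>R sgn (w i)) (at 0)"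
      unfolding c_def by (auto intro!: derivative_eq_intros)
    then show "((\<lambda>t. c t i) has_vector_derivative w i) (at 0)"
      by (cases "w i = 0") (simp_all add: sgn_div_norm)
  qed
  then show ?thesis
    unfolding deformation_curve_def by blast
qed

end

theory Submission
  imports Defs
begin

text \<open>
  An isometric first-order deformation moves each edge as an infinitesimal rotation:
  \<open>w\<^sub>i = r\<^sub>i \<times> p\<^sub>i\<close> and \<open>w\<^sub>i\<^sub>+\<^sub>1 = r\<^sub>i \<times> p\<^sub>i\<^sub>+\<^sub>1\<close>.  The rotations of the two edges at \<open>p\<^sub>i\<close> agree on \<open>p\<^sub>i\<close>,
  so \<open>r\<^sub>i - r\<^sub>i\<^sub>-\<^sub>1 = l\<^sub>i p\<^sub>i\<close> for a real number \<open>l\<^sub>i\<close>, and the angle at \<open>p\<^sub>i\<close> varies by \<open>- s l\<^sub>i\<close>.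
  Summing over the cycle gives the equation.  Conversely, if the equation holds, then
  \<open>r\<^sub>i = - s (a\<^sub>0 p\<^sub>0 + \<dots> + a\<^sub>i p\<^sub>i)\<close> closes up around the cycle, and \<open>w\<^sub>i = r\<^sub>i \<times> p\<^sub>i\<close> is the required
  deformation.
\<close>

section \<open>Derivatives of angles modulo 2 pi\<close>

lemma cis_has_vector_derivative:
  assumes "(\<theta> has_real_derivative d) (at t0)"
  shows "((\<lambda>t. cis (\<theta> t)) has_vector_derivative \<i> * of_real d * cis (\<theta> t0)) (at t0)"
proof -
  have "((\<lambda>t. complex_of_real (\<theta> t)) has_vector_derivative of_real d) (at t0)"
    using assms has_vector_derivative_of_real has_real_derivative_iff_has_vector_derivative by blast
  then have "((\<lambda>z. exp (\<i> * z)) \<circ> (\<lambda>t. complex_of_real (\<theta> t)) has_vector_derivative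
      of_real d * (exp (\<i> * of_real (\<theta> t0)) * \<i>)) (at t0)"
    by (rule field_vector_diff_chain_at) (auto intro!: derivative_eq_intros)
  then show ?thesis
    by (simp add: o_def cis_conv_exp mult_ac)
qed

text \<open>The two lifts may differ by multiples of 2 pi, but \<open>cis\<close> identifies them
  near \<open>t0\<close>. Both then give the same derivative, and the nonzero factor
  \<open>cis (\<theta> t0)\<close> cancels.\<close>

lemma has_angle_derivative_unique:
  assumes "has_angle_derivative f d t0" "has_angle_derivative f e t0"
  shows "d = e"
proof -
  obtain \<theta> \<eta> where
    \<theta>: "\<forall>\<^sub>F t in nhds t0. [f t = \<theta> t] (rmod 2 * pi)" "(\<theta> has_real_derivative d) (at t0)" and
    \<eta>: "\<forall>\<^sub>F t in nhds t0. [f t = \<eta> t] (rmod 2 * pi)" "(\<eta> has_real_derivative e) (at t0)"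
    using assms unfolding has_angle_derivative_def by blast
  have ev: "\<forall>\<^sub>F t in nhds t0. cis (\<theta> t) = cis (\<eta> t)"
    using \<theta>(1) \<eta>(1) by eventually_elim (metis cis_eq_iff)
  have "((\<lambda>t. cis (\<theta> t)) has_vector_derivative \<i> * of_real e * cis (\<eta> t0)) (at t0)"
    using cis_has_vector_derivative[OF \<eta>(2)] eventually_nhds_x_imp_x[OF ev] ev
    by (subst has_vector_derivative_cong_ev[where g = "\<lambda>t. cis (\<eta> t)"]) auto
  with cis_has_vector_derivative[OF \<theta>(2)]
  have "\<i> * of_real d * cis (\<theta> t0) = \<i> * of_real e * cis (\<eta> t0)"
    by (rule vector_derivative_unique_at)
  then show ?thesis
    using eventually_nhds_x_imp_x[OF ev] by simp
qed

text \<open>The logarithmic derivative of \<open>Z\<close> at \<open>t0\<close> is purely imaginary: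
  to first order \<open>Z\<close> only turns, at rate \<open>d\<close>.\<close>

lemma has_angle_derivative_Arg:
  fixes Z :: "real \<Rightarrow> complex"
  assumes Z: "(Z has_vector_derivative \<i> * of_real d * Z t0) (at t0)" and nz: "Z t0 \<noteq> 0"
  shows "has_angle_derivative (\<lambda>t. Arg (Z t)) d t0"
proof -
  \<comment> \<open>\<open>Arg\<close> jumps at the negative real axis. The quotient is 1 at
    \<open>t0\<close>, where \<open>Ln\<close> is smooth, so this lift is differentiable for every
    nonzero \<open>Z t0\<close>.\<close>
  define \<theta> where "\<theta> t = Arg (Z t0) + Im (Ln (Z t / Z t0))" for t
  have "((\<lambda>z. Ln (z / Z t0)) \<circ> Z has_vector_derivative \<i> * of_real d * Z t0 * (1 / Z t0)) (at t0)"
    by (rule field_vector_diff_chain_at[OF Z]) (use nz in \<open>auto intro!: derivative_eq_intros\<close>)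
  then have "((\<lambda>t. Im (Ln (Z t / Z t0))) has_vector_derivative d) (at t0)"
    using bounded_linear.has_vector_derivative[OF bounded_linear_Im] nz by (fastforce simp: o_def)
  then have "(\<theta> has_real_derivative d) (at t0)"
    unfolding \<theta>_def has_real_derivative_iff_has_vector_derivative
    by (auto intro!: derivative_eq_intros)
  moreover have "\<forall>\<^sub>F t in nhds t0. Z t \<noteq> 0"
    using has_vector_derivative_continuous[OF Z] nz
    by (auto simp: eventually_nhds_conv_at continuous_at intro: tendsto_imp_eventually_ne)
  then have "\<forall>\<^sub>F t in nhds t0. [Arg (Z t) = \<theta> t] (rmod 2 * pi)"
  proof eventually_elim
    case (elim t)
    then have "cis (\<theta> t) = sgn (Z t0) * sgn (Z t / Z t0)"
      using nz by (simp add: \<theta>_def cis_mult[symmetric] cis_Arg flip: Arg_eq_Im_Ln)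
    also have "\<dots> = sgn (Z t)"
      using nz by (simp only: sgn_mult[symmetric]) simp
    finally show ?case
      using elim by (metis cis_Arg cis_eq_iff)
  qed
  ultimately show ?thesis
    unfolding has_angle_derivative_def by blast
qed

section \<open>Cross products and infinitesimal rotations\<close>

lemma cross_nonzero:
  fixes x y :: "real^3"
  assumes "norm x = 1" "norm y = 1" "x \<noteq> y" "x \<noteq> - y"
  shows "x \<times> y \<noteq> 0"
proof
  assume "x \<times> y = 0"
  then have y: "y = (x \<bullet> y) *\<^sub>R x"
    using Lagrange[of x x y] assms(1) by (simp add: norm_eq_1)
  then have "\<bar>x \<bullet> y\<bar> = 1"
    using assms by (metis norm_scaleR mult.right_neutral)
  then have "y = x \<or> y = - x"
    using y by (auto simp: abs_if split: if_splits)
  then show False using assms by auto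
qed

lemma cross_eq_imp_diff_parallel:
  fixes x r r' :: "real^3"
  assumes "norm x = 1" "r \<times> x = r' \<times> x"
  shows "r - r' = ((r - r') \<bullet> x) *\<^sub>R x"
proof -
  have "x \<times> (r - r') = 0"
    using assms(2) by (metis Cross3.left_diff_distrib cross_skew diff_self neg_equal_0_iff_equal)
  then show ?thesis
    using Lagrange[of x x "r - r'"] assms(1) by (simp add: norm_eq_1 inner_commute)
qed

text \<open>The rotation vector \<open>x \<times> x'\<close> already moves \<open>x\<close>
  correctly. Its error \<open>e\<close> at \<open>y\<close> is orthogonal to \<open>y\<close> by
  tangency and to \<open>x\<close> by isometry, hence a multiple of \<open>x \<times> y\<close>;
  adding a multiple of \<open>x\<close> to the rotation vector removes it without affecting
  \<open>x\<close>.\<close>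

lemma infinitesimal_rotation_of_segment:
  fixes x y x' y' :: "real^3"
  assumes "norm x = 1" "norm y = 1" "x \<times> y \<noteq> 0"
    and "x' \<bullet> x = 0" "y' \<bullet> y = 0" "x' \<bullet> y + x \<bullet> y' = 0"
  shows "\<exists>r. x' = r \<times> x \<and> y' = r \<times> y"
proof -
  define e where "e = y' - (x \<times> x') \<times> y"
  have xc: "(x \<times> x') \<times> v = (x \<bullet> v) *\<^sub>R x' - (x' \<bullet> v) *\<^sub>R x" for v
    using Lagrange[of v x x'] cross_skew[of "x \<times> x'" v] by (simp add: inner_commute)
  have e: "e \<bullet> x = 0" "e \<bullet> y = 0"
    using assms by (simp_all add: e_def xc inner_diff_left norm_eq_1 inner_commute[of y' x])
  then have "(x \<times> y) \<times> e = 0"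
    using Lagrange[of e x y] cross_skew[of "x \<times> y" e] by (simp add: inner_commute)
  then have par: "((x \<times> y) \<bullet> (x \<times> y)) *\<^sub>R e = ((x \<times> y) \<bullet> e) *\<^sub>R (x \<times> y)"
    using Lagrange[of "x \<times> y" "x \<times> y" e] by simp
  define m where "m = ((x \<times> y) \<bullet> e) / ((x \<times> y) \<bullet> (x \<times> y))"
  have "e = m *\<^sub>R (x \<times> y)"
    using arg_cong[OF par, of "\<lambda>v. v /\<^sub>R ((x \<times> y) \<bullet> (x \<times> y))"] assms(3)
    by (simp add: m_def divide_inverse mult.commute)
  then have "y' = (x \<times> x' + m *\<^sub>R x) \<times> y"
    by (simp add: e_def cross_add_left cross_mult_left algebra_simps)
  moreover have "x' = (x \<times> x' + m *\<^sub>R x) \<times> x"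
    using assms by (simp add: cross_add_left cross_mult_left xc norm_eq_1)
  ultimately show ?thesis by blast
qed

section \<open>The angle as the argument of a polynomial expression\<close>

text \<open>
  A positive multiple of the complex number whose argument is the angle at x of the triangle x, y, z.
  Unlike the unit edge directions it is polynomial in x, y, z, which makes it easy to differentiate.
\<close>

definition angle_number :: "real \<Rightarrow> real^3 \<Rightarrow> real^3 \<Rightarrow> real^3 \<Rightarrow> complex" where
  "angle_number s x y z = Complex (y \<bullet> z - (x \<bullet> y) * (x \<bullet> z)) (s * (x \<bullet> (y \<times> z)))"

text \<open>Normalizing the two projections only introduces a positive factor, which
  \<open>Arg\<close> ignores.\<close>

lemma oriented_angle_edge_direction:
  assumes "norm x = 1"
  shows "oriented_angle s x (edge_direction x y) (edge_direction x z) = Arg (angle_number s x y z)"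
proof -
  define u v where "u = y - (x \<bullet> y) *\<^sub>R x" and "v = z - (x \<bullet> z) *\<^sub>R x"
  have re: "u \<bullet> v = y \<bullet> z - (x \<bullet> y) * (x \<bullet> z)"
    using assms by (simp add: u_def v_def inner_diff_left inner_diff_right norm_eq_1 inner_commute)
  have im: "(x \<times> u) \<bullet> v = x \<bullet> (y \<times> z)"
    by (simp add: u_def v_def Cross3.right_diff_distrib cross_mult_right inner_diff_right dot_cross_self)
       (simp add: cross3_simps)
  have Z: "Complex (sgn u \<bullet> sgn v) ((s *\<^sub>R (x \<times> sgn u)) \<bullet> sgn v) =
      of_real (inverse (norm v) * inverse (norm u)) * angle_number s x y z"
    by (simp del: of_real_mult of_real_inverse add: complex_eq_iff angle_number_def sgn_div_norm cross_mult_right re im)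
  show ?thesis
  proof (cases "u = 0 \<or> v = 0")
    \<comment> \<open>Since \<open>sgn 0 = 0\<close>, both complex numbers vanish here. The formula
      therefore holds along any curve on the sphere, even where neighbouring vertices become equal
      or antipodal.\<close>
    case True
    then have "angle_number s x y z = 0"
      unfolding angle_number_def re[symmetric] im[symmetric] by (auto simp: complex_eq_iff)
    with Z show ?thesis
      by (simp add: oriented_angle_def edge_direction_def u_def v_def)
  next
    case False
    then have "0 < inverse (norm v) * inverse (norm u)"
      by simp
    then show ?thesis
      unfolding oriented_angle_def edge_direction_def u_def[symmetric] v_def[symmetric] Z
      by (rule Arg_times_of_real)
  qed
qed

text \<open>The real part is the inner product of \<open>x \<times> y\<close> and
  \<open>x \<times> z\<close>, and the imaginary part determines their cross product. Both vanish
  only if one of these vectors is zero.\<close>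

lemma angle_number_nonzero:
  assumes "s \<noteq> 0" "norm x = 1" "x \<times> y \<noteq> 0" "x \<times> z \<noteq> 0"
  shows "angle_number s x y z \<noteq> 0"
proof
  assume "angle_number s x y z = 0"
  then have 0: "y \<bullet> z - (x \<bullet> y) * (x \<bullet> z) = 0" "x \<bullet> (y \<times> z) = 0"
    using assms by (auto simp: angle_number_def complex_eq_iff)
  have "(x \<times> y) \<bullet> (x \<times> z) = 0"
    using 0 assms by (simp add: dot_cross norm_eq_1 inner_commute)
  moreover have "(x \<times> y) \<times> (x \<times> z) = (x \<bullet> (y \<times> z)) *\<^sub>R x"
    using exhaust_3 by (force simp add: cross3_simps)
  ultimately show False
    using 0 assms norm_and_cross_eq_0 by (metis scale_zero_left)
qed

lemmas has_vector_derivative_inner =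
  bounded_bilinear.has_vector_derivative[OF bounded_bilinear_inner]

lemmas has_vector_derivative_cross =
  bounded_bilinear.has_vector_derivative[OF bilinear_cross[unfolded bilinear_conv_bounded_bilinear]]

text \<open>A common rotation \<open>r\<close> of all three points leaves the number unchanged. Only
  the extra rotation of \<open>z\<close> about \<open>x\<close>, at rate \<open>- l\<close>,
  contributes; it turns the tangent plane at \<open>x\<close>, with sign \<open>s\<close>.\<close>

lemma angle_number_has_vector_derivative:
  fixes x y z :: "real \<Rightarrow> real^3"
  assumes s: "s * s = 1" and x0: "norm (x 0) = 1"
    and x: "(x has_vector_derivative r \<times> x 0) (at 0)"
    and y: "(y has_vector_derivative r \<times> y 0) (at 0)"
    and z: "(z has_vector_derivative (r - l *\<^sub>R x 0) \<times> z 0) (at 0)"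
  shows "((\<lambda>t. angle_number s (x t) (y t) (z t)) has_vector_derivative
           \<i> * of_real (- s * l) * angle_number s (x 0) (y 0) (z 0)) (at 0)"
proof -
  let ?R = "\<lambda>t. y t \<bullet> z t - (x t \<bullet> y t) * (x t \<bullet> z t)"
  let ?I = "\<lambda>t. x t \<bullet> (y t \<times> z t)"
  have rot: "u \<bullet> (r \<times> v) + (r \<times> u) \<bullet> v = 0" for u v
    by (simp add: cross3_simps)
  have yz: "y 0 \<bullet> ((r - l *\<^sub>R x 0) \<times> z 0) + (r \<times> y 0) \<bullet> z 0 = l * ?I 0"
    by (simp add: cross3_simps)
  have xz: "x 0 \<bullet> ((r - l *\<^sub>R x 0) \<times> z 0) + (r \<times> x 0) \<bullet> z 0 = 0"
    by (simp add: cross3_simps)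
  have yxz: "x 0 \<bullet> (y 0 \<times> ((r - l *\<^sub>R x 0) \<times> z 0) + (r \<times> y 0) \<times> z 0) + (r \<times> x 0) \<bullet> (y 0 \<times> z 0)
      = - l * ((x 0 \<bullet> x 0) * (y 0 \<bullet> z 0) - (x 0 \<bullet> y 0) * (x 0 \<bullet> z 0))"
    by (simp add: cross3_simps)
  have "(?R has_vector_derivative l * ?I 0 - ((x 0 \<bullet> y 0) * 0 + 0 * (x 0 \<bullet> z 0))) (at 0)"
    using has_vector_derivative_inner[OF y z] has_vector_derivative_inner[OF x y]
      has_vector_derivative_inner[OF x z]
    unfolding yz xz rot by (intro has_vector_derivative_diff has_vector_derivative_mult)
  then have "(?R has_vector_derivative l * ?I 0) (at 0)"
    by simp
  moreover have "(?I has_vector_derivative - l * ?R 0) (at 0)"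
    using has_vector_derivative_inner[OF x has_vector_derivative_cross[OF y z]] x0
    unfolding yxz by (simp add: norm_eq_1)
  ultimately have "((\<lambda>t. complex_of_real (?R t) + \<i> * of_real (s * ?I t)) has_vector_derivative
      of_real (l * ?I 0) + \<i> * of_real (s * (- l * ?R 0))) (at 0)"
    unfolding has_real_derivative_iff_has_vector_derivative[symmetric]
    by (intro has_vector_derivative_add has_vector_derivative_mult_right
        has_vector_derivative_of_real DERIV_cmult)
  \<comment> \<open>\<open>s * s = 1\<close> lets the real part absorb the two factors
    \<open>s\<close>, one from the rate and one from the imaginary part.\<close>
  moreover have "of_real (l * ?I 0) + \<i> * of_real (s * (- l * ?R 0)) =
     \<i> * of_real (- s * l) * angle_number s (x 0) (y 0) (z 0)"
    using s by (simp add: angle_number_def complex_eq_iff)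
  moreover have "(\<lambda>t. complex_of_real (?R t) + \<i> * of_real (s * ?I t)) = (\<lambda>t. angle_number s (x t) (y t) (z t))"
    by (simp add: angle_number_def complex_eq_iff fun_eq_iff)
  ultimately show ?thesis by simp
qed


section \<open>Cyclic indices and edge rotations of polygons\<close>

lemma pred_mod_less: "i < n \<Longrightarrow> (i + n - 1) mod n < n"
  and Suc_pred_mod: "i < n \<Longrightarrow> ((i + n - 1) mod n + 1) mod n = i"
  and pred_Suc_mod: "i < n \<Longrightarrow> ((i + 1) mod n + n - 1) mod n = i"
  for i n :: nat
proof -
  assume i: "i < n"
  then show "(i + n - 1) mod n < n"
    by simp
  show "((i + n - 1) mod n + 1) mod n = i"
    using i by (cases i) auto
  show "((i + 1) mod n + n - 1) mod n = i"
    using i by (cases "Suc i = n") auto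
qed

lemma sum_pred_mod:
  fixes r :: "nat \<Rightarrow> 'a::comm_monoid_add"
  shows "(\<Sum>i<n. r ((i + n - 1) mod n)) = (\<Sum>i<n. r i)"
proof (rule sum.reindex_bij_betw)
  show "bij_betw (\<lambda>i. (i + n - 1) mod n) {..<n} {..<n}"
    by (rule bij_betw_byWitness[where f' = "\<lambda>i. (i + 1) mod n"])
       (use pred_mod_less Suc_pred_mod pred_Suc_mod in auto)
qed

lemma spherical_polygonD:
  assumes "spherical_polygon n p" "i < n"
  shows "norm (p i) = 1" "p i \<times> p ((i + 1) mod n) \<noteq> 0"
proof -
  have "norm (p j) = 1" if "j < n" for j
    using assms(1) that by (simp add: spherical_polygon_def)
  then show "norm (p i) = 1" "p i \<times> p ((i + 1) mod n) \<noteq> 0"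
    using assms cross_nonzero[of "p i" "p ((i + 1) mod n)"] by (auto simp: spherical_polygon_def)
qed

lemma angle_variation_of_edge_rotations:
  assumes s: "s * s = 1" and polygon: "spherical_polygon n p"
    and w: "\<And>i. i < n \<Longrightarrow> w i = r i \<times> p i"
    and l: "\<And>i. i < n \<Longrightarrow> r i - r ((i + n - 1) mod n) = l i *\<^sub>R p i"
  shows "angle_variation s n p w (\<lambda>i. - s * l i)"
  unfolding angle_variation_def
proof (intro allI impI)
  fix c i
  assume c: "deformation_curve n p w c" and i: "i < n"
  define j k where "j = (i + 1) mod n" and "k = (i + n - 1) mod n"
  have j: "j < n" "(j + n - 1) mod n = i" and k: "k < n" "(k + 1) mod n = i"
    using i pred_mod_less[OF i] Suc_pred_mod[OF i] pred_Suc_mod[OF i] by (simp_all add: j_def k_def)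
  have c0: "c 0 m = p m" "((\<lambda>t. c t m) has_vector_derivative w m) (at 0)" "norm (c t m) = 1"
    if "m < n" for m t
    using c that by (auto simp: deformation_curve_def)
  \<comment> \<open>\<open>r j\<close> and \<open>r i\<close> differ by a multiple of
    \<open>p j\<close>, which fixes \<open>p j\<close>; so \<open>r i\<close> moves both ends of the
    edge leaving \<open>p i\<close>.\<close>
  have "r j = r i + l j *\<^sub>R p j"
    using l[OF j(1)] j(2) by (simp add: algebra_simps)
  then have wj: "w j = r i \<times> p j"
    using w[OF j(1)] by (simp add: cross_add_left cross_mult_left)
  \<comment> \<open>The edge arriving at \<open>p i\<close> moves with the preceding rotation, which
    is \<open>r i\<close> corrected by a rotation about \<open>p i\<close>.\<close>
  have wk: "w k = (r i - l i *\<^sub>R p i) \<times> p k"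
    using w[OF k(1)] by (simp only: l[OF i, symmetric] k_def) simp
  let ?Z = "\<lambda>t. angle_number s (c t i) (c t j) (c t k)"
  have "p k \<times> p i \<noteq> 0"
    using spherical_polygonD(2)[OF polygon k(1)] k(2) by simp
  then have "p i \<times> p k \<noteq> 0"
    using cross_skew[of "p i" "p k"] by simp
  moreover have "s \<noteq> 0"
    using s by auto
  ultimately have nz: "?Z 0 \<noteq> 0"
    using spherical_polygonD[OF polygon i] unfolding c0(1)[OF i] c0(1)[OF j(1)] c0(1)[OF k(1)]
    by (intro angle_number_nonzero) (simp_all add: j_def)
  have "(?Z has_vector_derivative \<i> * of_real (- s * l i) * ?Z 0) (at 0)"
    by (rule angle_number_has_vector_derivative[where r = "r i"])
       (use s c0[OF i] c0[OF j(1)] c0[OF k(1)] w[OF i] wj wk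
          spherical_polygonD(1)[OF polygon i] in simp_all)
  then have "has_angle_derivative (\<lambda>t. Arg (?Z t)) (- s * l i) 0"
    using nz by (rule has_angle_derivative_Arg)
  moreover have "polygon_angle s n (c t) i = Arg (?Z t)" for t
    using oriented_angle_edge_direction[OF c0(3)[OF i]]
    by (simp add: polygon_angle_def j_def k_def)
  ultimately show "has_angle_derivative (\<lambda>t. polygon_angle s n (c t) i) (- s * l i) 0"
    by simp
qed

text \<open>Since \<open>angle_variation\<close> quantifies over all deformation curves, one
  existing curve pins down its values.\<close>

lemma angle_variation_unique:
  assumes "spherical_polygon n p" "first_order_deformation n p w"
    and "angle_variation s n p w a" "angle_variation s n p w b" "i < n"
  shows "a i = b i"
proof -
  obtain c where "deformation_curve n p w c"
    using deformation_curve_exists[of n p w] assms(1,2) unfolding spherical_polygon_def by blast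
  then show ?thesis
    using assms(3-5) has_angle_derivative_unique unfolding angle_variation_def by blast
qed

lemma isometric_deformation_edge_rotations:
  assumes polygon: "spherical_polygon n p" and w: "isometric_deformation n p w"
  shows "\<exists>r. \<forall>i<n. w i = r i \<times> p i \<and> w ((i + 1) mod n) = r i \<times> p ((i + 1) mod n)"
proof -
  have "\<exists>r. w i = r \<times> p i \<and> w ((i + 1) mod n) = r \<times> p ((i + 1) mod n)" if i: "i < n" for i
  proof (rule infinitesimal_rotation_of_segment)
    have "(i + 1) mod n < n"
      using i by simp
    then show "norm (p ((i + 1) mod n)) = 1" "w ((i + 1) mod n) \<bullet> p ((i + 1) mod n) = 0"
      using spherical_polygonD(1)[OF polygon] w
      by (auto simp: isometric_deformation_def first_order_deformation_def)
    show "norm (p i) = 1" "p i \<times> p ((i + 1) mod n) \<noteq> 0"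
      using spherical_polygonD[OF polygon i] by auto
    show "w i \<bullet> p i = 0" "w i \<bullet> p ((i + 1) mod n) + p i \<bullet> w ((i + 1) mod n) = 0"
      using w i by (auto simp: isometric_deformation_def first_order_deformation_def)
  qed
  then show ?thesis by metis
qed

section \<open>The two implications\<close>

lemma angle_variation_sum_zero:
  assumes s: "s * s = 1" and polygon: "spherical_polygon n p"
    and w: "isometric_deformation n p w" and a: "angle_variation s n p w a"
  shows "(\<Sum>i<n. a i *\<^sub>R p i) = 0"
proof -
  obtain r where r: "\<And>i. i < n \<Longrightarrow> w i = r i \<times> p i"
      "\<And>i. i < n \<Longrightarrow> w ((i + 1) mod n) = r i \<times> p ((i + 1) mod n)"
    using isometric_deformation_edge_rotations[OF polygon w] by blast
  define l where "l i = (r i - r ((i + n - 1) mod n)) \<bullet> p i" for i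
  have l: "r i - r ((i + n - 1) mod n) = l i *\<^sub>R p i" if i: "i < n" for i
    unfolding l_def
  proof (rule cross_eq_imp_diff_parallel)
    show "norm (p i) = 1"
      using spherical_polygonD[OF polygon i] by simp
    show "r i \<times> p i = r ((i + n - 1) mod n) \<times> p i"
      using r(1)[OF i] r(2)[OF pred_mod_less[OF i]] Suc_pred_mod[OF i] by simp
  qed
  have "angle_variation s n p w (\<lambda>i. - s * l i)"
    using s polygon r(1) l by (rule angle_variation_of_edge_rotations)
  then have "a i = - s * l i" if "i < n" for i
    using angle_variation_unique[OF polygon _ a _ that] w by (simp add: isometric_deformation_def)
  then have "(\<Sum>i<n. a i *\<^sub>R p i) = (\<Sum>i<n. (- s) *\<^sub>R (r i - r ((i + n - 1) mod n)))"
    by (intro sum.cong) (simp_all only: lessThan_iff l scaleR_scaleR)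
  \<comment> \<open>The predecessor map permutes the indices, so the differences cancel around the
    cycle.\<close>
  also have "\<dots> = 0"
    by (simp only: scaleR_sum_right[symmetric] sum_subtractf sum_pred_mod) simp
  finally show ?thesis .
qed

lemma isometric_deformation_with_angle_variation:
  assumes s: "s * s = 1" and polygon: "spherical_polygon n p"
    and a: "(\<Sum>i<n. a i *\<^sub>R p i) = 0"
  shows "\<exists>w. isometric_deformation n p w \<and> angle_variation s n p w a"
proof -
  define r where "r i = (- s) *\<^sub>R (\<Sum>j\<le>i. a j *\<^sub>R p j)" for i
  define w where "w i = r i \<times> p i" for i
  have l: "r i - r ((i + n - 1) mod n) = (- s * a i) *\<^sub>R p i" if i: "i < n" for i
  proof (cases i)
    case 0
    \<comment> \<open>The predecessor of 0 is the last index, where \<open>r\<close> is a multiple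
      of the full sum; the equation makes it zero, so the rotations close up.\<close>
    then have "r ((i + n - 1) mod n) = 0"
      using i a by (cases n) (auto simp: r_def lessThan_Suc_atMost)
    with 0 show ?thesis
      by (simp add: r_def)
  next
    case (Suc m)
    then have "(i + n - 1) mod n = m"
      using i by simp
    with Suc show ?thesis
      by (simp add: r_def algebra_simps)
  qed
  have "w ((i + 1) mod n) = r i \<times> p ((i + 1) mod n)" if i: "i < n" for i
  proof -
    have "r ((i + 1) mod n) = r i + (- s * a ((i + 1) mod n)) *\<^sub>R p ((i + 1) mod n)"
      using l[of "(i + 1) mod n"] i pred_Suc_mod[OF i] by (simp add: algebra_simps)
    then show ?thesis
      by (simp only: w_def cross_add_left cross_mult_left) simp
  qed
  moreover have "(r i \<times> x) \<bullet> y + x \<bullet> (r i \<times> y) = 0" for i x y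
    by (simp add: cross3_simps)
  ultimately have "isometric_deformation n p w"
    by (simp add: isometric_deformation_def first_order_deformation_def w_def dot_cross_self)
  \<comment> \<open>The factor \<open>- s\<close> in \<open>r\<close> meets the \<open>- s\<close>
    of the angle formula, and \<open>s * s = 1\<close> returns \<open>a\<close>.\<close>
  moreover have "angle_variation s n p w (\<lambda>i. - s * (- s * a i))"
    using s polygon w_def l by (rule angle_variation_of_edge_rotations)
  then have "angle_variation s n p w a"
    using s by (simp flip: mult.assoc)
  ultimately show ?thesis by blast
qed

theorem mainTheorem2:
  fixes s :: real and n :: nat and p :: "nat \<Rightarrow> real^3"
  assumes orientation: "s = 1 \<or> s = -1"
    and polygon: "spherical_polygon n p"
  shows "(\<forall>w a. isometric_deformation n p w \<and> angle_variation s n p w a \<longrightarrow>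
            (\<Sum>i<n. a i *\<^sub>R p i) = 0) \<and>
         ((\<nexists>C. great_circle C \<and> (\<forall>i<n. p i \<in> C)) \<longrightarrow>
            (\<forall>a. (\<Sum>i<n. a i *\<^sub>R p i) = 0 \<longrightarrow>
               (\<exists>w. isometric_deformation n p w \<and> angle_variation s n p w a)))"
proof -
  have "s * s = 1"
    using orientation by auto
  then show ?thesis
    using angle_variation_sum_zero[OF _ polygon] isometric_deformation_with_angle_variation[OF _ polygon]
    by (metis (no_types, lifting))
qed

end
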